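(* Consider the noiseless ternary remotely powered channel with $\mathcal X=\mathcal Y=\{0,1,2\}$, $Y_t=X_t$, $\phi(x)=x$, battery capacity $\bar B=2$ and energy alphabet $\mathcal E=\{0,2\}$. Its capacity when the charger is adjacent to the transmitter (causally observes the channel input) is $$C_X(\Gamma)=\begin{cases}\big(1+\tfrac\Gamma2\big)\log\tfrac{2+\Gamma}{2\Gamma}-\big(1-\tfrac\Gamma2\big)\log\tfrac{2-\Gamma}{2\Gamma},&0\le\Gamma<2/3,\\[2pt]\tfrac12\Gamma+1,&2/3\le\Gamma<1,\\[2pt]\tfrac\Gamma2+H_2\big(\tfrac\Gamma2\big),&1\le\Gamma<4/3,\\[2pt]\log3,&4/3\le\Gamma,\end{cases}$$ where at $\Gamma=0$ the first expression is understood as its limit $0$ as $\Gamma\downarrow0$.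
   Context: Logarithms are to base 2; $H_2(p)=-p\log p-(1-p)\log(1-p)$ is the binary entropy function. The battery level satisfies $B_1=\bar B=2$ and $B_{t+1}=\min\{B_t+E_t,\bar B\}-X_t$; the input must satisfy $X_t\le\min\{B_t+E_t,\bar B\}$, where $E_t\in\mathcal E$ is the energy sent by the charger at time $t$. Cost constraint: $\frac1n\sum_{t=1}^nE_t\le\Gamma$. An $(R,n)$ code with charger adjacent to the transmitter consists of a message set $\mathcal M=\{1,\dots,2^{nR}\}$ (rounded to an integer), transmitter functions $f_t^{\mathrm{Tx}}:\mathcal M\times\mathcal E^t\to\mathcal X$ ($x_t=f_t^{\mathrm{Tx}}(m,e^t)$), charger functions $f_t^{\mathrm C}:\mathcal X^{t-1}\to\mathcal E$ ($E_t=f_t^{\mathrm C}(X^{t-1})$), and a decoder $\mathcal Y^n\to\mathcal M$ giving $\hat M$, such that the energy constraints and the cost constraint hold for every realization. The error probability is $P_e=|\mathcal M|^{-1}\sum_m\Pr(\hat M\ne m\mid m\text{ sent})$; $R$ is achievable if there is a sequence of $(R,n)$ codes with $P_e\to0$; $C_X(\Gamma)$ is the supremum of achievable rates. *)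

theory Defs
  imports "HOL-Probability.Probability"
begin

definition binary_entropy :: "real \<Rightarrow> real" where
  "binary_entropy p = - p * log 2 p - (1 - p) * log 2 (1 - p)"

text \<open>A remotely powered channel: a memoryless channel \<open>kernel\<close> whose input \<open>x\<close> costs the
  transmitter the energy \<open>usage x\<close>, taken from a battery of size \<open>battery_cap\<close> that is recharged
  with energies from the charger's alphabet \<open>energies\<close>.\<close>

record ('x, 'y) rp_channel =
  inputs :: "'x set"
  outputs :: "'y set"
  kernel :: "'x \<Rightarrow> 'y pmf"
  usage :: "'x \<Rightarrow> real"
  battery_cap :: real
  energies :: "real set"

text \<open>A block code with the charger adjacent to the transmitter. The time index \<open>t\<close> starts at 1:
  \<open>transmit c t m [E\<^sub>1,\<dots>,E\<^sub>t]\<close> is the input at time \<open>t\<close> and \<open>charge c t [X\<^sub>1,\<dots>,X\<^sub>t\<^sub>-\<^sub>1]\<close> is the energy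
  sent at time \<open>t\<close>.\<close>

record ('x, 'y) rp_code =
  transmit :: "nat \<Rightarrow> nat \<Rightarrow> real list \<Rightarrow> 'x"
  charge :: "nat \<Rightarrow> 'x list \<Rightarrow> real"
  decode :: "'y list \<Rightarrow> nat"

text \<open>The energies and channel inputs during the first \<open>t\<close> steps when \<open>m\<close> is sent. Neither
  terminal sees the channel output, so both sequences are determined by \<open>m\<close>.\<close>

primrec run :: "('x, 'y) rp_code \<Rightarrow> nat \<Rightarrow> nat \<Rightarrow> real list \<times> 'x list" where
  "run c m 0 = ([], [])"
| "run c m (Suc t) =
     (let (es, xs) = run c m t;
          es' = es @ [charge c (Suc t) xs];
          xs' = xs @ [transmit c (Suc t) m es']
      in (es', xs'))"

text \<open>List positions start at 0, so \<open>battery ch es xs t\<close> is the level \<open>B\<^sub>t\<^sub>+\<^sub>1\<close>, before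
  \<open>E\<^sub>t\<^sub>+\<^sub>1 = es ! t\<close> arrives and \<open>X\<^sub>t\<^sub>+\<^sub>1 = xs ! t\<close> is transmitted. The battery is initially full.\<close>

primrec battery :: "('x, 'y) rp_channel \<Rightarrow> real list \<Rightarrow> 'x list \<Rightarrow> nat \<Rightarrow> real" where
  "battery ch es xs 0 = battery_cap ch"
| "battery ch es xs (Suc t) =
     min (battery ch es xs t + es ! t) (battery_cap ch) - usage ch (xs ! t)"

definition energy_feasible :: "('x, 'y) rp_channel \<Rightarrow> real list \<Rightarrow> 'x list \<Rightarrow> bool" where
  "energy_feasible ch es xs \<longleftrightarrow>
     (\<forall>t<length xs. usage ch (xs ! t) \<le> min (battery ch es xs t + es ! t) (battery_cap ch))"

text \<open>The number \<open>2\<^sup>n\<^sup>R\<close> of messages is rounded up.\<close>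

definition messages :: "real \<Rightarrow> nat \<Rightarrow> nat set" where
  "messages R n = {1..nat \<lceil>2 powr (real n * R)\<rceil>}"

definition adjacent_code ::
    "('x, 'y) rp_channel \<Rightarrow> real \<Rightarrow> real \<Rightarrow> nat \<Rightarrow> ('x, 'y) rp_code \<Rightarrow> bool" where
  "adjacent_code ch \<Gamma> R n c \<longleftrightarrow>
     (\<forall>t\<in>{1..n}. \<forall>m\<in>messages R n. \<forall>es.
        length es = t \<and> set es \<subseteq> energies ch \<longrightarrow> transmit c t m es \<in> inputs ch) \<and>
     (\<forall>t\<in>{1..n}. \<forall>xs.
        length xs = t - 1 \<and> set xs \<subseteq> inputs ch \<longrightarrow> charge c t xs \<in> energies ch) \<and>
     (\<forall>ys. length ys = n \<and> set ys \<subseteq> outputs ch \<longrightarrow> decode c ys \<in> messages R n) \<and>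
     (\<forall>m\<in>messages R n.
        energy_feasible ch (fst (run c m n)) (snd (run c m n)) \<and>
        (1 / real n) * sum_list (fst (run c m n)) \<le> \<Gamma>)"

primrec output_pmf :: "('x, 'y) rp_channel \<Rightarrow> 'x list \<Rightarrow> 'y list pmf" where
  "output_pmf ch [] = return_pmf []"
| "output_pmf ch (x # xs) =
     bind_pmf (kernel ch x) (\<lambda>y. map_pmf (\<lambda>ys. y # ys) (output_pmf ch xs))"

definition error_prob ::
    "('x, 'y) rp_channel \<Rightarrow> real \<Rightarrow> nat \<Rightarrow> ('x, 'y) rp_code \<Rightarrow> real" where
  "error_prob ch R n c =
     (\<Sum>m\<in>messages R n.
        measure_pmf.prob (output_pmf ch (snd (run c m n))) {ys. decode c ys \<noteq> m})
     / real (card (messages R n))"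

definition achievable :: "('x, 'y) rp_channel \<Rightarrow> real \<Rightarrow> real \<Rightarrow> bool" where
  "achievable ch \<Gamma> R \<longleftrightarrow> 0 \<le> R \<and>
     (\<exists>c. (\<forall>n\<ge>1. adjacent_code ch \<Gamma> R n (c n)) \<and> (\<lambda>n. error_prob ch R n (c n)) \<longlonglongrightarrow> 0)"

text \<open>Extended-real valued, so that the supremum exists whether or not the rates are bounded.\<close>

definition capacity_adjacent :: "('x, 'y) rp_channel \<Rightarrow> real \<Rightarrow> ereal" where
  "capacity_adjacent ch \<Gamma> = (SUP R\<in>{R. achievable ch \<Gamma> R}. ereal R)"

definition noiseless_ternary :: "(nat, nat) rp_channel" where
  "noiseless_ternary =
     \<lparr>inputs = {0, 1, 2}, outputs = {0, 1, 2}, kernel = return_pmf, usage = real,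
      battery_cap = 2, energies = {0, 2}\<rparr>"

end

theory Submission
  imports Defs "HOL-Real_Asymp.Real_Asymp"
begin

text \<open>A zero-error code is a set of input sequences, all compatible with one charging policy.
  Such sets form a tree whose nodes carry the battery level and the number \<open>K\<close> of recharges left.

  Converse: if a potential \<open>v\<close> of the battery level satisfies
  \<open>(\<Sum>y\<le>b. v y) \<le> \<rho> * v b\<close> and \<open>\<mu> * (\<Sum>y\<le>2. v y) \<le> \<rho> * v b\<close>, then the tree of depth \<open>n\<close>
  has at most \<open>C * \<rho> ^ n / \<mu> ^ K\<close> leaves, whence \<open>R \<le> log 2 \<rho> - \<Gamma> / 2 * log 2 \<mu>\<close>.
  The Perron eigenvectors of two policies serve as potentials: recharge unless the battery is full
  (optimal for \<open>\<mu> \<ge> 1 / 2\<close>, that is \<open>\<Gamma> \<ge> 1\<close>), and recharge only the empty battery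
  (optimal for \<open>\<mu> \<le> 1 / 2\<close>, that is \<open>\<Gamma> \<le> 2 / 3\<close>); both are optimal at \<open>\<mu> = 1 / 2\<close>, which covers
  the gap.

  Achievability: with \<open>K\<close> recharges the two policies admit \<open>2 ^ K * (n choose K)\<close> and
  \<open>(n + K) choose (2 * K)\<close> sequences of length \<open>n\<close>. The entropy bound on binomial coefficients and
  time sharing between the policies give the matching rates.\<close>

section \<open>Feasible input sequences under a charging policy\<close>

text \<open>\<open>g\<close> decides from the past inputs whether to recharge, which fills the battery because the only
  positive energy equals its capacity; \<open>b\<close> is the battery level and \<open>K\<close> bounds the number of
  recharges still to come.\<close>

fun feasible :: "(nat list \<Rightarrow> bool) \<Rightarrow> nat \<Rightarrow> nat \<Rightarrow> nat list \<Rightarrow> bool" where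
  "feasible g b K [] \<longleftrightarrow> True"
| "feasible g b K (x # xs) \<longleftrightarrow>
     (if g [] then 0 < K \<and> x \<le> 2 \<and> feasible (\<lambda>ys. g (x # ys)) (2 - x) (K - 1) xs
      else x \<le> b \<and> feasible (\<lambda>ys. g (x # ys)) (b - x) K xs)"

text \<open>\<open>take i xs\<close> is the strict past: the energy at position \<open>i\<close> is
  fixed before the input there. The energies are thus a function of the policy and the
  inputs.\<close>

definition energy_list :: "(nat list \<Rightarrow> bool) \<Rightarrow> nat list \<Rightarrow> real list" where
  "energy_list g xs = map (\<lambda>i. if g (take i xs) then 2 else 0) [0..<length xs]"

lemma length_energy_list [simp]: "length (energy_list g xs) = length xs"
  by (simp add: energy_list_def)

lemma nth_energy_list:
  "i < length xs \<Longrightarrow> energy_list g xs ! i = (if g (take i xs) then 2 else 0)"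
  by (simp add: energy_list_def)

text \<open>Links the recursion of \<open>feasible\<close>, which consumes list and budget from the
  front, to the energy conditions, which refer to absolute positions. A general start
  \<open>t\<close> allows induction backwards from the end of the list.\<close>

lemma feasible_drop_iff:
  assumes "t \<le> length xs" "battery noiseless_ternary (energy_list g xs) xs t = real b" "b \<le> 2"
  shows "feasible (\<lambda>ys. g (take t xs @ ys)) b K (drop t xs) \<longleftrightarrow>
    (\<forall>i. t \<le> i \<and> i < length xs \<longrightarrow>
       real (xs ! i) \<le> min (battery noiseless_ternary (energy_list g xs) xs i + energy_list g xs ! i) 2) \<and>
    sum_list (drop t (energy_list g xs)) \<le> 2 * real K"
  using assms
proof (induction t arbitrary: b K rule: inc_induct)
  case base
  then show ?case by simp
next
  case (step t)
  let ?B = "battery noiseless_ternary (energy_list g xs) xs"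
  let ?es = "energy_list g xs"
  let ?P = "\<lambda>i. real (xs ! i) \<le> min (?B i + ?es ! i) 2"
  let ?x = "xs ! t"
  \<comment> \<open>The level available to the input: a recharge always fills the battery, because
    adding 2 to any level is capped at 2.\<close>
  define s where "s = (if g (take t xs) then 2 else b)"
  have d: "drop t xs = ?x # drop (Suc t) xs" "drop t ?es = ?es ! t # drop (Suc t) ?es"
    using step.hyps by (simp_all add: Cons_nth_drop_Suc)
  have tk: "take t xs @ ?x # ys = take (Suc t) xs @ ys" for ys
    using step.hyps by (simp add: take_Suc_conv_app_nth)
  have et: "?es ! t = (if g (take t xs) then 2 else 0)"
    using step.hyps by (simp add: nth_energy_list)
  have s: "min (?B t + ?es ! t) 2 = real s" "s \<le> 2"
    using step.prems by (auto simp: s_def et)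
  \<comment> \<open>For a recharge with \<open>K = 0\<close>: the remaining energies then sum to at
    least 2, so both sides of the equivalence fail.\<close>
  have nonneg: "0 \<le> sum_list (drop (Suc t) ?es)"
    by (intro sum_list_nonneg) (auto simp: energy_list_def dest!: in_set_dropD)
  have split: "(\<forall>i. t \<le> i \<and> i < length xs \<longrightarrow> ?P i) \<longleftrightarrow>
      ?P t \<and> (\<forall>i. Suc t \<le> i \<and> i < length xs \<longrightarrow> ?P i)"
    using step.hyps by (metis Suc_leD Suc_leI le_eq_less_or_eq)
  show ?case
  proof (cases "?x \<le> s")
    case False
    then have "\<not> ?P t" unfolding s by simp
    moreover have "\<not> feasible (\<lambda>ys. g (take t xs @ ys)) b K (drop t xs)"
      using False by (auto simp: d s_def)
    ultimately show ?thesis unfolding split by blast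
  next
    case True
    then have Pt: "?P t" unfolding s by simp
    have "?B (Suc t) = real (s - ?x)"
      using True s by (simp add: noiseless_ternary_def)
    moreover have "s - ?x \<le> 2" using s by simp
    ultimately have IH: "feasible (\<lambda>ys. g (take (Suc t) xs @ ys)) (s - ?x) K' (drop (Suc t) xs) \<longleftrightarrow>
      (\<forall>i. Suc t \<le> i \<and> i < length xs \<longrightarrow> ?P i) \<and> sum_list (drop (Suc t) ?es) \<le> 2 * real K'" for K'
      by (rule step.IH)
    show ?thesis
    proof (cases "g (take t xs)")
      case True
      then have "feasible (\<lambda>ys. g (take t xs @ ys)) b K (drop t xs) \<longleftrightarrow>
        0 < K \<and> feasible (\<lambda>ys. g (take (Suc t) xs @ ys)) (s - ?x) (K - 1) (drop (Suc t) xs)"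
        using \<open>?x \<le> s\<close> by (simp add: d tk s_def)
      then show ?thesis
        using Pt nonneg True unfolding IH split by (cases K) (auto simp: d et)
    next
      case False
      then have "feasible (\<lambda>ys. g (take t xs @ ys)) b K (drop t xs) \<longleftrightarrow>
        feasible (\<lambda>ys. g (take (Suc t) xs @ ys)) (s - ?x) K (drop (Suc t) xs)"
        using \<open>?x \<le> s\<close> by (simp add: d tk s_def)
      then show ?thesis
        using Pt False unfolding IH split by (auto simp: d et)
    qed
  qed
qed

lemma feasible_iff:
  "feasible g 2 K xs \<longleftrightarrow>
     energy_feasible noiseless_ternary (energy_list g xs) xs \<and> sum_list (energy_list g xs) \<le> 2 * real K"
proof -
  have "battery noiseless_ternary (energy_list g xs) xs 0 = real 2"
    by (simp add: noiseless_ternary_def)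
  from feasible_drop_iff[OF _ this, of K] show ?thesis
    by (simp add: energy_feasible_def) (simp add: noiseless_ternary_def)
qed

lemma feasible_set: "feasible g b K xs \<Longrightarrow> b \<le> 2 \<Longrightarrow> set xs \<subseteq> {0, 1, 2}"
proof (induction g b K xs rule: feasible.induct)
  case (2 g b K x xs)
  then show ?case
    by (auto split: if_splits)
qed simp

lemma finite_feasible: "b \<le> 2 \<Longrightarrow> finite {xs. length xs = n \<and> feasible g b K xs}"
  by (rule finite_subset[OF _ finite_lists_length_eq[of "{0, 1, 2 :: nat}" n]])
     (auto dest!: feasible_set)

section \<open>Growth of the tree of feasible sequences\<close>

text \<open>By induction on \<open>n\<close>: each step contributes a factor \<open>\<rho>\<close>,
  each recharge a factor \<open>1 / \<mu>\<close>, and \<open>idle\<close> and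
  \<open>charged\<close> are the inductive step at a node of level \<open>b\<close>. The exponent
  \<open>Suc K\<close> fits the normalisation \<open>\<mu> \<le> v b\<close>, which makes the bound
  at least 1 for the empty sequence.\<close>

lemma card_feasible_le:
  fixes v :: "nat \<Rightarrow> real"
  assumes mu: "0 < \<mu>" "\<mu> \<le> 1" and rho: "0 \<le> \<rho>"
    and v: "\<And>b. b \<le> 2 \<Longrightarrow> \<mu> \<le> v b"
    and idle: "\<And>b. b \<le> 2 \<Longrightarrow> (\<Sum>y\<le>b. v y) \<le> \<rho> * v b"
    and charged: "\<And>b. b \<le> 2 \<Longrightarrow> \<mu> * (\<Sum>y\<le>2. v y) \<le> \<rho> * v b"
    and "b \<le> 2"
  shows "real (card {xs. length xs = n \<and> feasible g b K xs}) \<le> v b * \<rho> ^ n / \<mu> ^ Suc K"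
  using \<open>b \<le> 2\<close>
proof (induction n arbitrary: g b K)
  case 0
  have "{xs. length xs = 0 \<and> feasible g b K xs} = {[]}" by auto
  moreover have "\<mu> ^ Suc K \<le> \<mu>" using mu by (simp add: mult_left_le power_le_one)
  moreover have "\<mu> \<le> v b" using v[OF 0] .
  ultimately show ?case using mu
    by (simp add: le_divide_eq del: power_Suc)
next
  case (Suc n)
  let ?F = "\<lambda>g b K. {xs. length xs = n \<and> feasible g b K xs}"
  have step: "real (card (\<Union>x\<le>s. (#) x ` ?F (\<lambda>ys. g (x # ys)) (s - x) K'))
      \<le> (\<Sum>y\<le>s. v y) * \<rho> ^ n / \<mu> ^ Suc K'" if "s \<le> 2" for s K'
  proof -
    have "card (\<Union>x\<le>s. (#) x ` ?F (\<lambda>ys. g (x # ys)) (s - x) K')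
        \<le> (\<Sum>x\<le>s. card ((#) x ` ?F (\<lambda>ys. g (x # ys)) (s - x) K'))"
      by (rule card_UN_le) simp
    also have "\<dots> = (\<Sum>x\<le>s. card (?F (\<lambda>ys. g (x # ys)) (s - x) K'))"
      by (intro sum.cong refl card_image) simp
    finally have "real (card (\<Union>x\<le>s. (#) x ` ?F (\<lambda>ys. g (x # ys)) (s - x) K'))
        \<le> (\<Sum>x\<le>s. real (card (?F (\<lambda>ys. g (x # ys)) (s - x) K')))"
      unfolding of_nat_sum[symmetric] of_nat_le_iff .
    also have "\<dots> \<le> (\<Sum>x\<le>s. v (s - x) * \<rho> ^ n / \<mu> ^ Suc K')"
      using that by (intro sum_mono Suc.IH) simp
    also have "\<dots> = (\<Sum>x\<le>s. v (s - x)) * \<rho> ^ n / \<mu> ^ Suc K'"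
      by (simp add: sum_distrib_right sum_divide_distrib)
    also have "(\<Sum>x\<le>s. v (s - x)) = (\<Sum>y\<le>s. v y)"
      using sum.atLeastAtMost_rev[of v 0 s] by (simp add: atMost_atLeast0)
    finally show ?thesis .
  qed
  show ?case
  proof (cases "g []")
    case True
    show ?thesis
    proof (cases K)
      case 0
      then have "{xs. length xs = Suc n \<and> feasible g b K xs} = {}"
        using True by (auto simp: length_Suc_conv)
      moreover have "0 \<le> v b" using v[OF Suc.prems] mu by simp
      ultimately show ?thesis using mu rho by (simp only: card.empty) simp
    next
      case (Suc K')
      have "{xs. length xs = Suc n \<and> feasible g b K xs}
          = (\<Union>x\<le>2. (#) x ` ?F (\<lambda>ys. g (x # ys)) (2 - x) K')"
        using True Suc by (auto simp: length_Suc_conv)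
      then have "real (card {xs. length xs = Suc n \<and> feasible g b K xs})
          \<le> (\<Sum>y\<le>2. v y) * \<rho> ^ n / \<mu> ^ K"
        using step[of 2 K'] Suc by simp
      \<comment> \<open>The spent recharge leaves one factor \<open>\<mu>\<close>, which
        \<open>charged\<close> absorbs.\<close>
      also have "\<dots> = (\<mu> * (\<Sum>y\<le>2. v y)) * (\<rho> ^ n / \<mu> ^ Suc K)"
        using mu by simp
      also have "\<dots> \<le> (\<rho> * v b) * (\<rho> ^ n / \<mu> ^ Suc K)"
        using charged[OF Suc.prems] mu rho by (intro mult_right_mono) auto
      finally show ?thesis by (simp add: mult_ac)
    qed
  next
    case False
    have "{xs. length xs = Suc n \<and> feasible g b K xs}
        = (\<Union>x\<le>b. (#) x ` ?F (\<lambda>ys. g (x # ys)) (b - x) K)"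
      using False by (auto simp: length_Suc_conv)
    then have "real (card {xs. length xs = Suc n \<and> feasible g b K xs})
        \<le> (\<Sum>y\<le>b. v y) * (\<rho> ^ n / \<mu> ^ Suc K)"
      using step[of b K] Suc by simp
    also have "\<dots> \<le> (\<rho> * v b) * (\<rho> ^ n / \<mu> ^ Suc K)"
      using idle[OF Suc.prems] mu rho by (intro mult_right_mono) auto
    finally show ?thesis by (simp add: mult_ac)
  qed
qed

section \<open>Explicit sets of codewords\<close>

text \<open>A single policy \<open>g\<close> has to serve the whole set \<open>S\<close>. Asking
  only for \<open>N \<le> card S\<close> makes lower bounds enough in the recurrences.\<close>

definition codewords :: "nat \<Rightarrow> nat \<Rightarrow> nat \<Rightarrow> nat \<Rightarrow> bool" where
  "codewords b n K N \<longleftrightarrow>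
     (\<exists>g S. finite S \<and> N \<le> card S \<and> (\<forall>xs\<in>S. length xs = n \<and> feasible g b K xs))"

lemma codewords_0: "N \<le> 1 \<Longrightarrow> codewords b 0 K N"
  unfolding codewords_def by (intro exI[of _ "\<lambda>_. False"] exI[of _ "{[]}"]) auto

lemma codewords_none: "codewords b n K 0"
  unfolding codewords_def by (intro exI[of _ "\<lambda>_. False"] exI[of _ "{}"]) auto

text \<open>The charger observes the first input \<open>x\<close>, so it can continue with the
  policy chosen for the level \<open>b - x\<close>. Distinct first inputs keep the sets
  disjoint.\<close>

lemma codewords_idle:
  assumes "\<And>y. y \<le> b \<Longrightarrow> codewords y n K (N y)"
  shows "codewords b (Suc n) K (\<Sum>y\<le>b. N y)"
proof -
  obtain g S where gS: "\<And>y. y \<le> b \<Longrightarrow> finite (S y) \<and> N y \<le> card (S y) \<and>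
      (\<forall>xs\<in>S y. length xs = n \<and> feasible (g y) y K xs)"
    using assms unfolding codewords_def by metis
  define G where "G = (\<lambda>xs. case xs of [] \<Rightarrow> False | x # ys \<Rightarrow> g (b - x) ys)"
  define T where "T = (\<Union>x\<le>b. (#) x ` S (b - x))"
  have "card T = (\<Sum>x\<le>b. card ((#) x ` S (b - x)))"
    unfolding T_def using gS by (intro card_UN_disjoint) auto
  also have "\<dots> = (\<Sum>x\<le>b. card (S (b - x)))"
    by (intro sum.cong refl card_image) simp
  also have "\<dots> = (\<Sum>y\<le>b. card (S y))"
    using sum.atLeastAtMost_rev[of "\<lambda>y. card (S y)" 0 b] by (simp add: atMost_atLeast0)
  finally have "(\<Sum>y\<le>b. N y) \<le> card T"
    using gS by (auto intro: sum_mono)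
  moreover have "finite T" using gS by (auto simp: T_def)
  moreover have "\<forall>xs\<in>T. length xs = Suc n \<and> feasible G b K xs"
  proof
    fix xs assume "xs \<in> T"
    then obtain x ys where "x \<le> b" "ys \<in> S (b - x)" "xs = x # ys"
      by (auto simp: T_def)
    then show "length xs = Suc n \<and> feasible G b K xs"
      using gS[of "b - x"] by (auto simp: G_def)
  qed
  ultimately show ?thesis unfolding codewords_def by blast
qed

text \<open>Only the first decision of \<open>g\<close> is overridden. If \<open>g\<close> idles
  first, the extra recharge supplies the full battery that \<open>g\<close> assumes; if
  \<open>g\<close> recharges anyway, the extra one is left over, which \<open>mono\<close>
  permits.\<close>

lemma codewords_charge:
  assumes "codewords 2 n K N" "0 < n"
  shows "codewords b n (Suc K) N"
proof -
  obtain g S where gS: "finite S" "N \<le> card S"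
    "\<And>xs. xs \<in> S \<Longrightarrow> length xs = n \<and> feasible g 2 K xs"
    using assms unfolding codewords_def by metis
  define G where "G = (\<lambda>xs. case xs of [] \<Rightarrow> True | _ \<Rightarrow> g xs)"
  have mono: "feasible h c K' xs \<Longrightarrow> feasible h c (Suc K') xs" for h c K' xs
    by (induction h c K' xs rule: feasible.induct) (auto split: if_splits simp: gr0_conv_Suc)
  have "feasible G b (Suc K) xs" if "xs \<in> S" for xs
  proof (cases xs)
    case Nil
    then show ?thesis by simp
  next
    case (Cons x ys)
    then have "feasible g 2 K (x # ys)" using gS(3)[OF that] unfolding Cons by blast
    then show ?thesis
      using Cons mono[of _ _ "K - 1" ys] by (cases "g []") (auto simp: G_def)
  qed
  then show ?thesis using gS unfolding codewords_def by blast
qed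

text \<open>Recharging only the empty battery.\<close>

lemma codewords_charge_empty:
  "codewords 2 n K ((n + K) choose (2 * K)) \<and>
   (0 < K \<longrightarrow> codewords 1 n K ((n + K - 1) choose (2 * K - 1)))"
proof (induction n arbitrary: K)
  case 0
  show ?case
    by (cases K) (simp_all add: codewords_0 binomial_eq_0)
next
  case (Suc n)
  have two: "codewords 2 n K ((n + K) choose (2 * K))" for K using Suc by blast
  have one: "codewords 1 n (Suc K) ((n + K) choose (2 * K + 1))" for K
    using Suc[of "Suc K"] by simp
  have zero: "codewords 0 n (Suc K) (if n = 0 then if K = 0 then 1 else 0 else (n + K) choose (2 * K))" for K
    using two[of K] codewords_charge[of n K _ 0] by (auto intro: codewords_0)
  have zero': "codewords 0 n (Suc K) ((n + K) choose (2 * K))" for K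
    using zero[of K] by (cases "n = 0"; cases "K = 0") (auto simp: binomial_eq_0)
  show ?case
  proof (cases K)
    case 0
    \<comment> \<open>Without recharges only the all-zero sequence is counted; input 0 keeps the
      battery full.\<close>
    have "codewords 2 (Suc n) 0 (\<Sum>y\<le>2::nat. if y = 2 then 1 else 0)"
      using two[of 0] by (intro codewords_idle) (auto simp: codewords_none)
    then show ?thesis using 0 by simp
  next
    case (Suc J)
    \<comment> \<open>Pascal's rule at level 1: input 1 empties the battery, which is refilled at
      once, and input 0 stays at level 1.\<close>
    have "codewords 1 (Suc n) K (\<Sum>y\<le>1::nat. if y = 0 then (n + J) choose (2 * J) else (n + J) choose (2 * J + 1))"
      using one[of J] zero'[of J] Suc by (intro codewords_idle) (auto simp: le_Suc_eq)
    then have a: "codewords 1 (Suc n) K ((n + K) choose (2 * J + 1))"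
      using Suc by simp
    \<comment> \<open>Pascal's rule at level 2: inputs 2 and 1 together give
      \<open>(n + K) choose (2 * J + 1)\<close>, and input 0 adds
      \<open>(n + K) choose (2 * K)\<close>.\<close>
    have "codewords 2 (Suc n) K (\<Sum>y\<le>2::nat. if y = 0 then (n + J) choose (2 * J)
        else if y = 1 then (n + J) choose (2 * J + 1) else (n + K) choose (2 * K))"
      using one[of J] zero'[of J] two[of K] Suc
      by (intro codewords_idle) (auto simp: le_Suc_eq numeral_2_eq_2)
    then have "codewords 2 (Suc n) K ((Suc n + K) choose (2 * K))"
      using Suc by (simp add: numeral_2_eq_2 add_ac)
    then show ?thesis using a Suc by simp
  qed
qed

text \<open>Recharging after every nonzero input, followed by codewords of length \<open>m\<close>.\<close>

lemma codewords_charge_nonfull: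
  assumes "codewords 2 m L N" "0 < m"
  shows "codewords 2 (n + m) (K + L) (2 ^ K * (n choose K) * N)"
proof (induction n arbitrary: K)
  case 0
  then show ?case using assms by (cases K) (auto simp: codewords_none)
next
  case (Suc n)
  show ?case
  proof (cases K)
    case 0
    have "codewords 2 (Suc (n + m)) L (\<Sum>y\<le>2::nat. if y = 2 then N else 0)"
      using Suc[of 0] by (intro codewords_idle) (auto simp: codewords_none)
    then show ?thesis using 0 by simp
  next
    case (Suc J)
    \<comment> \<open>Every level is refilled at once, so inputs 1 and 2 have equal counts; this
      gives the factor 2, and Pascal's rule does the rest.\<close>
    have "codewords y (n + m) (K + L) (2 ^ J * (n choose J) * N)" for y
      using codewords_charge[OF Suc.IH[of J]] assms Suc by simp
    then have "codewords 2 (Suc (n + m)) (K + L)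
       (\<Sum>y\<le>2::nat. if y = 2 then 2 ^ K * (n choose K) * N else 2 ^ J * (n choose J) * N)"
      using Suc.IH[of K] by (intro codewords_idle) auto
    moreover have "(\<Sum>y\<le>(2::nat). if y = 2 then 2 ^ K * (n choose K) * N else 2 ^ J * (n choose J) * N)
        = 2 ^ K * (Suc n choose K) * N"
      using Suc by (simp add: numeral_2_eq_2 algebra_simps)
    ultimately show ?thesis by simp
  qed
qed

section \<open>Entropy bound for binomial coefficients\<close>

text \<open>\<open>k ^ j / fact j\<close> is maximal at \<open>j = k\<close>: passing from
  \<open>j\<close> to \<open>j + 1\<close> multiplies it by \<open>k / (j + 1)\<close>, which is at
  least 1 exactly while \<open>j < k\<close>.\<close>

lemma fact_mult_power_le: "fact k * k ^ j \<le> fact j * (k::nat) ^ k"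
proof (cases "j \<le> k")
  case True
  have "fact (j + d) * k ^ j \<le> fact j * k ^ (j + d)" if "j + d \<le> k" for d
    using that
  proof (induction d)
    case (Suc d)
    have "fact (j + Suc d) * k ^ j = (j + Suc d) * (fact (j + d) * k ^ j)"
      by (simp add: algebra_simps)
    also have "\<dots> \<le> k * (fact j * k ^ (j + d))"
      by (rule mult_le_mono[OF Suc.prems Suc.IH]) (use Suc.prems in simp)
    finally show ?case by (simp add: mult_ac)
  qed simp
  from this[of "k - j"] show ?thesis using True by simp
next
  case False
  have "fact k * k ^ (k + d) \<le> fact (k + d) * k ^ k" for d
  proof (induction d)
    case (Suc d)
    have "fact k * k ^ (k + Suc d) = k * (fact k * k ^ (k + d))"
      by simp
    also have "\<dots> \<le> (k + Suc d) * (fact (k + d) * k ^ k)"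
      by (rule mult_le_mono[OF _ Suc.IH]) simp
    finally show ?case by (simp add: algebra_simps)
  qed simp
  from this[of "j - k"] show ?thesis using False by simp
qed

text \<open>The term with index \<open>k\<close> is the largest one in the binomial expansion of \<open>(k + (n - k)) ^ n\<close>.\<close>

lemma power_self_le_binomial:
  assumes "k \<le> n"
  shows "n ^ n \<le> (n + 1) * ((n choose k) * k ^ k * (n - k) ^ (n - k))"
proof -
  have le: "(n choose j) * k ^ j * (n - k) ^ (n - j) \<le> (n choose k) * k ^ k * (n - k) ^ (n - k)"
    if "j \<le> n" for j
  proof -
    \<comment> \<open>Multiplying by \<open>?c\<close> clears denominators: both binomial
      coefficients become \<open>fact n\<close>, and \<open>fact_mult_power_le\<close> for
      \<open>k\<close> and for \<open>n - k\<close> remains.\<close>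
    let ?c = "fact j * fact (n - j) * (fact k * fact (n - k)) :: nat"
    have "(n choose j) * k ^ j * (n - k) ^ (n - j) * ?c
        = (fact j * fact (n - j) * (n choose j)) * ((fact k * k ^ j) * (fact (n - k) * (n - k) ^ (n - j)))"
      by (simp only: mult_ac)
    also have "\<dots> \<le> (fact j * fact (n - j) * (n choose j)) * ((fact j * k ^ k) * (fact (n - j) * (n - k) ^ (n - k)))"
      by (intro mult_mono fact_mult_power_le) auto
    also have "\<dots> = (fact k * fact (n - k) * (n choose k)) * ((fact j * k ^ k) * (fact (n - j) * (n - k) ^ (n - k)))"
      using that assms by (simp only: binomial_fact_lemma)
    also have "\<dots> = (n choose k) * k ^ k * (n - k) ^ (n - k) * ?c"
      by (simp only: mult_ac)
    finally show ?thesis by (subst (asm) mult_le_cancel2) simp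
  qed
  have "n ^ n = (k + (n - k)) ^ n" using assms by simp
  also have "\<dots> = (\<Sum>j\<le>n. (n choose j) * k ^ j * (n - k) ^ (n - j))"
    by (simp add: binomial)
  also have "\<dots> \<le> (\<Sum>j\<le>n. (n choose k) * k ^ k * (n - k) ^ (n - k))"
    using le by (intro sum_mono) simp
  finally show ?thesis by simp
qed

definition xlogx :: "real \<Rightarrow> real" where "xlogx x = x * log 2 x"

text \<open>For \<open>0 \<le> b \<le> a\<close> and \<open>0 < a\<close> this is
  \<open>a * binary_entropy (b / a)\<close>, the growth rate of
  \<open>(n * a) choose (n * b)\<close>. Written without quotients, it is continuous at the boundary
  as well.\<close>

definition binomial_exponent :: "real \<Rightarrow> real \<Rightarrow> real" where
  "binomial_exponent a b = xlogx a - xlogx b - xlogx (a - b)"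

lemma xlogx_0 [simp]: "xlogx 0 = 0"
  by (simp add: xlogx_def)

lemma isCont_xlogx: "isCont xlogx a"
proof (cases "a = 0")
  case False
  then show ?thesis unfolding xlogx_def log_def by (intro continuous_intros) auto
next
  case True
  have "((\<lambda>x::real. x * log 2 x) \<longlongrightarrow> 0) (at_right 0)"
    by real_asymp
  \<comment> \<open>\<open>log 2 (- x) = log 2 x\<close>, so the function is odd and the left limit
    follows from the right one.\<close>
  moreover have "((\<lambda>x::real. x * log 2 x) \<longlongrightarrow> 0) (at_left 0)"
    using tendsto_minus[OF calculation] unfolding at_left_minus[of "0::real"]
    by (simp add: filterlim_filtermap log_def ln_minus)
  ultimately show ?thesis
    by (simp add: isCont_def True filterlim_at_split xlogx_def [abs_def])
qed

lemma log_power_self: "log 2 (real k ^ k) = xlogx (real k)"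
  by (cases "k = 0") (simp_all add: xlogx_def log_nat_power)

lemma binomial_exponent_le:
  assumes "k \<le> n"
  shows "binomial_exponent (real n) (real k) - log 2 (real n + 1) \<le> log 2 (real (n choose k))"
proof -
  have pos: "0 < real (n choose k)" "\<And>m::nat. 0 < real m ^ m"
    using assms by (auto simp: zero_less_power_eq)
  have log_prod: "log 2 (x * (y * z * w)) = log 2 x + log 2 y + log 2 z + log 2 w"
    if "0 < x" "0 < y" "0 < z" "0 < w" for x y z w :: real
    using that by (simp add: log_mult_pos)
  have "real n ^ n \<le> (real n + 1) * (real (n choose k) * real k ^ k * real (n - k) ^ (n - k))"
    using power_self_le_binomial[OF assms]
    by (metis (no_types, lifting) of_nat_1 of_nat_add of_nat_le_iff of_nat_mult of_nat_power)
  then have "log 2 (real n ^ n) \<le> log 2 ((real n + 1) * (real (n choose k) * real k ^ k * real (n - k) ^ (n - k)))"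
    using pos by (intro log_mono) auto
  also have "\<dots> = log 2 (real n + 1) + log 2 (real (n choose k)) + log 2 (real k ^ k) + log 2 (real (n - k) ^ (n - k))"
    by (rule log_prod) (use assms in \<open>auto simp: zero_less_power_eq\<close>)
  finally show ?thesis
    using assms by (simp only: log_power_self binomial_exponent_def of_nat_diff [symmetric])
qed

text \<open>The terms with \<open>log 2 c\<close> cancel because
  \<open>a - b - (a - b) = 0\<close>.\<close>

lemma binomial_exponent_scale:
  assumes "0 < c"
  shows "binomial_exponent (c * a) (c * b) = c * binomial_exponent a b"
proof -
  have scale: "xlogx (c * x) = c * xlogx x + c * x * log 2 c" for x
    using assms by (cases "x = 0") (simp_all add: xlogx_def log_mult algebra_simps)
  show ?thesis
    unfolding binomial_exponent_def right_diff_distrib[symmetric] scale by (simp add: algebra_simps)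
qed

lemma tendsto_binomial_exponent:
  assumes "(f \<longlongrightarrow> a) F" "(g \<longlongrightarrow> b) F"
  shows "((\<lambda>x. binomial_exponent (f x) (g x)) \<longlongrightarrow> binomial_exponent a b) F"
  unfolding binomial_exponent_def
  by (intro tendsto_diff isCont_tendsto_compose[OF isCont_xlogx] assms)

text \<open>\<open>A n\<close> grows at most linearly, so the logarithmic loss in
  \<open>binomial_exponent_le\<close> vanishes after division by \<open>n\<close>; homogeneity and
  continuity of the exponent give the limit.\<close>

lemma eventually_binomial_ge:
  fixes A B :: "nat \<Rightarrow> nat"
  assumes A: "(\<lambda>n. real (A n) / real n) \<longlonglongrightarrow> a" and B: "(\<lambda>n. real (B n) / real n) \<longlonglongrightarrow> b"
    and le: "\<forall>\<^sub>F n in sequentially. B n \<le> A n"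
    and r: "r < binomial_exponent a b"
  shows "\<forall>\<^sub>F n in sequentially. real n * r \<le> log 2 (real (A n choose B n))"
proof -
  have "(\<lambda>n. log 2 (real (A n) + 1) / real n) \<longlonglongrightarrow> 0"
  proof (rule tendsto_sandwich[OF _ _ tendsto_const])
    have ub: "\<forall>\<^sub>F n in sequentially. real (A n) / real n < a + 1"
      using A by (rule order_tendstoD) simp
    then show "\<forall>\<^sub>F n in sequentially. log 2 (real (A n) + 1) / real n \<le> log 2 ((\<bar>a\<bar> + 1) * real n + 1) / real n"
      using eventually_gt_at_top[of 0]
    proof eventually_elim
      case (elim n)
      then have "real (A n) \<le> (\<bar>a\<bar> + 1) * real n"
        by (smt (verit) mult_right_mono of_nat_0_less_iff pos_divide_less_eq)
      then show ?case by (intro divide_right_mono log_mono) auto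
    qed
    show "(\<lambda>n. log 2 ((\<bar>a\<bar> + 1) * real n + 1) / real n) \<longlonglongrightarrow> 0"
    proof -
      define c where "c = \<bar>a\<bar> + 1"
      have "0 < c" by (simp add: c_def)
      then show ?thesis unfolding c_def[symmetric] by real_asymp
    qed
  qed (auto intro!: always_eventually)
  then have "(\<lambda>n. binomial_exponent (real (A n) / real n) (real (B n) / real n) - log 2 (real (A n) + 1) / real n)
      \<longlonglongrightarrow> binomial_exponent a b - 0"
    by (intro tendsto_diff tendsto_binomial_exponent A B)
  then have "\<forall>\<^sub>F n in sequentially.
      r < binomial_exponent (real (A n) / real n) (real (B n) / real n) - log 2 (real (A n) + 1) / real n"
    using r by (intro order_tendstoD) auto
  then show ?thesis using le eventually_gt_at_top[of 0]
  proof eventually_elim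
    case (elim n)
    then have "real n * r < real n * binomial_exponent (real (A n) / real n) (real (B n) / real n)
        - log 2 (real (A n) + 1)"
      by (simp add: field_simps)
    also have "real n * binomial_exponent (real (A n) / real n) (real (B n) / real n)
        = binomial_exponent (real (A n)) (real (B n))"
      using elim by (simp flip: binomial_exponent_scale)
    also have "\<dots> - log 2 (real (A n) + 1) \<le> log 2 (real (A n choose B n))"
      using elim by (intro binomial_exponent_le)
    finally show ?case by simp
  qed
qed

section \<open>Codes from sets of codewords\<close>

text \<open>Message \<open>m\<close> is sent as the fixed sequence \<open>w m\<close>. The default
  output 1 of the decoder is always a message.\<close>

definition charger_code ::
    "(nat list \<Rightarrow> bool) \<Rightarrow> (nat \<Rightarrow> nat list) \<Rightarrow> nat set \<Rightarrow> (nat, nat) rp_code" where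
  "charger_code g w M =
     \<lparr>transmit = (\<lambda>t m es. w m ! (t - 1)), charge = (\<lambda>t xs. if g xs then 2 else 0),
      decode = (\<lambda>ys. if ys \<in> w ` M then inv_into M w ys else 1)\<rparr>"

lemma output_pmf_noiseless: "output_pmf noiseless_ternary xs = return_pmf xs"
  by (induction xs) (simp_all add: noiseless_ternary_def bind_return_pmf)

lemma error_prob_noiseless:
  "error_prob noiseless_ternary R n c =
     real (card {m \<in> messages R n. decode c (snd (run c m n)) \<noteq> m}) / real (card (messages R n))"
proof -
  have "finite (messages R n)" by (simp add: messages_def)
  then show ?thesis
    by (simp add: error_prob_def output_pmf_noiseless indicator_def measure_return_pmf
        Int_def Collect_conj_eq[symmetric])
qed

lemma one_in_messages: "1 \<in> messages R n"
proof -
  have "0 < \<lceil>2 powr (real n * R)\<rceil>" by simp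
  then show ?thesis unfolding messages_def by (simp add: Suc_le_eq)
qed

lemma run_charger_code:
  "t \<le> length (w m) \<Longrightarrow>
     run (charger_code g w M) m t = (take t (energy_list g (w m)), take t (w m))"
  by (induction t)
    (simp_all add: charger_code_def Let_def take_Suc_conv_app_nth nth_energy_list)

lemma adjacent_charger_code:
  assumes w: "\<And>m. m \<in> messages R n \<Longrightarrow> length (w m) = n \<and> feasible g 2 K (w m)"
    and "2 * real K \<le> real n * \<Gamma>" "1 \<le> n"
  shows "adjacent_code noiseless_ternary \<Gamma> R n (charger_code g w (messages R n))"
  unfolding adjacent_code_def
proof (intro conjI ballI allI impI)
  fix t m and es :: "real list"
  assume "t \<in> {1..n}" "m \<in> messages R n"
  then have "w m ! (t - 1) \<in> set (w m)" using w by (intro nth_mem) auto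
  then show "transmit (charger_code g w (messages R n)) t m es \<in> inputs noiseless_ternary"
    using feasible_set[of g 2 K "w m"] w[OF \<open>m \<in> messages R n\<close>]
    by (auto simp: charger_code_def noiseless_ternary_def)
next
  fix ys
  show "decode (charger_code g w (messages R n)) ys \<in> messages R n"
    using one_in_messages by (auto simp: charger_code_def inv_into_into)
next
  fix m assume m: "m \<in> messages R n"
  have "run (charger_code g w (messages R n)) m n = (energy_list g (w m), w m)"
    using w[OF m] by (subst run_charger_code) auto
  moreover have "energy_feasible noiseless_ternary (energy_list g (w m)) (w m)"
    "sum_list (energy_list g (w m)) \<le> real n * \<Gamma>"
    using w[OF m] assms(2) unfolding feasible_iff by auto
  ultimately show
    "energy_feasible noiseless_ternary (fst (run (charger_code g w (messages R n)) m n))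
       (snd (run (charger_code g w (messages R n)) m n))"
    "1 / real n * sum_list (fst (run (charger_code g w (messages R n)) m n)) \<le> \<Gamma>"
    using \<open>1 \<le> n\<close> by (simp_all add: field_simps)
qed (auto simp: charger_code_def noiseless_ternary_def)

lemma error_prob_charger_code:
  assumes "inj_on w (messages R n)" "\<And>m. m \<in> messages R n \<Longrightarrow> length (w m) = n"
  shows "error_prob noiseless_ternary R n (charger_code g w (messages R n)) = 0"
proof -
  have "decode (charger_code g w (messages R n)) (snd (run (charger_code g w (messages R n)) m n)) = m"
    if "m \<in> messages R n" for m
    using that assms by (subst run_charger_code) (auto simp: charger_code_def)
  then have "{m \<in> messages R n. decode (charger_code g w (messages R n))
      (snd (run (charger_code g w (messages R n)) m n)) \<noteq> m} = {}"
    by blast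
  then show ?thesis unfolding error_prob_noiseless by (simp only: card.empty div_0 of_nat_0)
qed

text \<open>Messages are mapped injectively to codewords, with error 0. A code is due at every
  length, so the finitely many lengths without enough codewords get the all-zero sequence, which
  takes no recharge.\<close>

lemma achievableI:
  assumes "0 \<le> R" "0 \<le> \<Gamma>"
    and codewords: "\<forall>\<^sub>F n in sequentially. \<exists>K N. codewords 2 n K N \<and>
      2 * real K \<le> real n * \<Gamma> \<and> 2 powr (real n * R) \<le> real N"
  shows "achievable noiseless_ternary \<Gamma> R"
proof -
  let ?P = "\<lambda>n. \<exists>K N. codewords 2 n K N \<and> 2 * real K \<le> real n * \<Gamma> \<and> 2 powr (real n * R) \<le> real N"
  have "\<exists>c. adjacent_code noiseless_ternary \<Gamma> R n c \<and> (?P n \<longrightarrow> error_prob noiseless_ternary R n c = 0)"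
    if n: "1 \<le> n" for n
  proof (cases "?P n")
    case True
    then obtain K N g S where K: "2 * real K \<le> real n * \<Gamma>" and "2 powr (real n * R) \<le> real N"
      and S: "finite S" "N \<le> card S" "\<And>xs. xs \<in> S \<Longrightarrow> length xs = n \<and> feasible g 2 K xs"
      unfolding codewords_def by blast
    \<comment> \<open>\<open>N\<close> is an integer, so it also bounds the rounded-up number of
      messages.\<close>
    then have "card (messages R n) \<le> card S"
      by (simp add: messages_def ceiling_le_iff nat_le_iff)
    then obtain w where w: "w ` messages R n \<subseteq> S" "inj_on w (messages R n)"
      using card_le_inj[of "messages R n" S] S by (auto simp: messages_def)
    have "\<And>m. m \<in> messages R n \<Longrightarrow> length (w m) = n \<and> feasible g 2 K (w m)"
      using w S by blast
    then show ?thesis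
      using adjacent_charger_code[OF _ K n] error_prob_charger_code[OF w(2)] by blast
  next
    case False
    have "feasible (\<lambda>_. False) b 0 (replicate k 0)" for b k
      by (induction k) auto
    then have "adjacent_code noiseless_ternary \<Gamma> R n
        (charger_code (\<lambda>_. False) (\<lambda>_. replicate n 0) (messages R n))"
      using n \<open>0 \<le> \<Gamma>\<close> by (intro adjacent_charger_code[where K = 0]) auto
    then show ?thesis using False by blast
  qed
  then obtain c where c: "\<And>n. 1 \<le> n \<Longrightarrow> adjacent_code noiseless_ternary \<Gamma> R n (c n)"
    "\<And>n. 1 \<le> n \<Longrightarrow> ?P n \<Longrightarrow> error_prob noiseless_ternary R n (c n) = 0"
    by metis
  have "\<forall>\<^sub>F n in sequentially. error_prob noiseless_ternary R n (c n) = 0"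
    using codewords eventually_ge_at_top[of 1] by eventually_elim (use c in blast)
  then have "(\<lambda>n. error_prob noiseless_ternary R n (c n)) \<longlonglongrightarrow> 0"
    by (rule tendsto_eventually)
  then show ?thesis using c \<open>0 \<le> R\<close> unfolding achievable_def by blast
qed

section \<open>Sets of codewords from codes\<close>

lemma energy_list_snoc:
  "energy_list g (xs @ [x]) = energy_list g xs @ [if g xs then 2 else 0]"
  by (auto simp: energy_list_def)

text \<open>The charger of a code becomes a policy by reading the time off the length of the past.
  Alphabet membership is part of the induction because the code's conditions only speak about lists
  over the alphabets.\<close>

lemma adjacent_code_run:
  assumes c: "adjacent_code noiseless_ternary \<Gamma> R n c" and m: "m \<in> messages R n" and "t \<le> n"
  shows "length (snd (run c m t)) = t \<and> set (snd (run c m t)) \<subseteq> {0, 1, 2} \<and>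
    set (fst (run c m t)) \<subseteq> {0, 2} \<and>
    fst (run c m t) = energy_list (\<lambda>xs. charge c (Suc (length xs)) xs = 2) (snd (run c m t))"
  using \<open>t \<le> n\<close>
proof (induction t)
  case 0
  then show ?case by (simp add: energy_list_def)
next
  case (Suc t)
  define es xs where "es = fst (run c m t)" and "xs = snd (run c m t)"
  have IH: "length xs = t" "set xs \<subseteq> {0, 1, 2}" "set es \<subseteq> {0, 2}"
    "es = energy_list (\<lambda>xs. charge c (Suc (length xs)) xs = 2) xs"
    using Suc.IH[OF Suc_leD[OF Suc.prems]] unfolding es_def xs_def by blast+
  have "charge c (Suc t) xs \<in> energies noiseless_ternary"
    using c Suc.prems IH unfolding adjacent_code_def by (auto simp: noiseless_ternary_def)
  then have e: "charge c (Suc t) xs \<in> {0, 2}"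
    by (simp add: noiseless_ternary_def)
  let ?es = "es @ [charge c (Suc t) xs]"
  have "length ?es = Suc t \<and> set ?es \<subseteq> energies noiseless_ternary"
    using IH e by (auto simp: noiseless_ternary_def)
  then have "transmit c (Suc t) m ?es \<in> inputs noiseless_ternary"
    using c Suc.prems m unfolding adjacent_code_def by auto
  then have x: "transmit c (Suc t) m ?es \<in> {0, 1, 2}"
    by (simp add: noiseless_ternary_def)
  have "run c m (Suc t) = (?es, xs @ [transmit c (Suc t) m ?es])"
    by (simp add: es_def xs_def case_prod_beta Let_def)
  moreover have "?es = energy_list (\<lambda>xs. charge c (Suc (length xs)) xs = 2)
      (xs @ [transmit c (Suc t) m ?es])"
    unfolding energy_list_snoc using IH e by auto
  ultimately show ?case
    using IH e x by auto
qed

text \<open>Once the error is below \<open>1 / 2\<close>, at least half of the messages are decoded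
  correctly. Without noise their input sequences are distinct, and all are feasible for the policy
  of the charger.\<close>

lemma achievableD:
  assumes "achievable noiseless_ternary \<Gamma> R"
  shows "\<forall>\<^sub>F n in sequentially. \<exists>g.
    2 powr (real n * R) / 2 \<le>
      real (card {xs. length xs = n \<and> feasible g 2 (nat \<lfloor>real n * \<Gamma> / 2\<rfloor>) xs})"
proof -
  from assms obtain c where c: "\<And>n. 1 \<le> n \<Longrightarrow> adjacent_code noiseless_ternary \<Gamma> R n (c n)"
    and lim: "(\<lambda>n. error_prob noiseless_ternary R n (c n)) \<longlonglongrightarrow> 0"
    unfolding achievable_def by blast
  have "\<forall>\<^sub>F n in sequentially. error_prob noiseless_ternary R n (c n) < 1 / 2"
    using lim by (rule order_tendstoD) simp
  then show ?thesis using eventually_ge_at_top[of 1]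
  proof eventually_elim
    case (elim n)
    let ?M = "messages R n" and ?K = "nat \<lfloor>real n * \<Gamma> / 2\<rfloor>"
    define x where "x m = snd (run (c n) m n)" for m
    define g where "g = (\<lambda>xs. charge (c n) (Suc (length xs)) xs = 2)"
    define good where "good = {m \<in> ?M. decode (c n) (x m) = m}"
    let ?F = "{xs. length xs = n \<and> feasible g 2 ?K xs}"
    have "finite ?M" by (simp add: messages_def)
    have "0 < card ?M" using one_in_messages[of R n] \<open>finite ?M\<close> by (auto simp: card_gt_0_iff)
    have "card {m \<in> ?M. decode (c n) (x m) \<noteq> m} + card good = card ?M"
    proof -
      have "?M = {m \<in> ?M. decode (c n) (x m) \<noteq> m} \<union> good" by (auto simp: good_def)
      then show ?thesis
        using \<open>finite ?M\<close> by (metis (no_types, lifting) card_Un_disjoint good_def disjoint_iff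
            finite_Un mem_Collect_eq)
    qed
    moreover have "real (card {m \<in> ?M. decode (c n) (x m) \<noteq> m}) < real (card ?M) / 2"
      using elim(1) \<open>0 < card ?M\<close> unfolding error_prob_noiseless x_def[symmetric]
      by (simp add: field_simps)
    ultimately have "real (card ?M) / 2 \<le> real (card good)"
      by linarith
    moreover have "2 powr (real n * R) \<le> real (card ?M)"
      by (simp add: messages_def)
    moreover have "card good \<le> card ?F"
    proof (rule card_inj_on_le[where f = x])
      show "inj_on x good" by (rule inj_onI) (metis (mono_tags, lifting) good_def mem_Collect_eq)
      show "finite ?F" by (rule finite_feasible) simp
      show "x ` good \<subseteq> ?F"
      proof clarify
        fix m assume "m \<in> good"
        then have m: "m \<in> ?M" by (simp add: good_def)
        note run = adjacent_code_run[OF c[OF elim(2)] m order_refl, folded x_def g_def]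
        have "energy_feasible noiseless_ternary (energy_list g (x m)) (x m)"
          "1 / real n * sum_list (energy_list g (x m)) \<le> \<Gamma>"
          using c[OF elim(2)] m run unfolding adjacent_code_def x_def by auto
        \<comment> \<open>The total energy is an even integer, so half of the budget may be rounded
          down.\<close>
        moreover have "sum_list (energy_list g (x m)) \<le> 2 * real ?K"
        proof -
          obtain k :: nat where k: "sum_list (energy_list g (x m)) = 2 * real k"
          proof -
            have "sum_list (energy_list g xs) \<in> range (\<lambda>k::nat. 2 * real k)" for xs
            proof (induction xs rule: rev_induct)
              case Nil
              then show ?case by (auto simp: energy_list_def intro: image_eqI[of _ _ 0])
            next
              case (snoc y ys)
              then obtain k :: nat where "sum_list (energy_list g ys) = 2 * real k" by blast
              then have "sum_list (energy_list g (ys @ [y])) = 2 * real (if g ys then Suc k else k)"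
                by (simp add: energy_list_snoc)
              then show ?case by blast
            qed
            then show ?thesis using that by blast
          qed
          have "real k \<le> real n * \<Gamma> / 2"
            using calculation(2) elim(2) by (simp add: k field_simps)
          then have "int k \<le> \<lfloor>real n * \<Gamma> / 2\<rfloor>" by (simp add: le_floor_iff)
          then show ?thesis unfolding k by simp
        qed
        ultimately show "length (x m) = n \<and> feasible g 2 ?K (x m)"
          unfolding feasible_iff using run by simp
      qed
    qed
    ultimately show ?case by (intro exI[of _ g]) linarith
  qed
qed

section \<open>Upper bounds on achievable rates\<close>

text \<open>The counting bound with at most \<open>n * \<Gamma> / 2\<close> recharges has exponent
  \<open>r\<close> per step; a larger rate would keep an unbounded exponential below the constant
  \<open>C\<close>.\<close>

lemma achievable_le:
  fixes v :: "nat \<Rightarrow> real"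
  assumes R: "achievable noiseless_ternary \<Gamma> R" and "0 \<le> \<Gamma>"
    and mu: "0 < \<mu>" "\<mu> \<le> 1" and "0 < \<rho>"
    and v: "\<And>b. b \<le> 2 \<Longrightarrow> \<mu> \<le> v b"
    and idle: "\<And>b. b \<le> 2 \<Longrightarrow> (\<Sum>y\<le>b. v y) \<le> \<rho> * v b"
    and charged: "\<And>b. b \<le> 2 \<Longrightarrow> \<mu> * (\<Sum>y\<le>2. v y) \<le> \<rho> * v b"
  shows "R \<le> log 2 \<rho> - \<Gamma> / 2 * log 2 \<mu>"
proof (rule ccontr)
  define r where "r = log 2 \<rho> - \<Gamma> / 2 * log 2 \<mu>"
  define C where "C = 2 * v 2 / \<mu>"
  assume "\<not> ?thesis"
  then have "0 < R - r" by (simp add: r_def)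
  have "0 < v 2" using v[of 2] mu by simp
  have "\<forall>\<^sub>F n in sequentially. 2 powr (real n * (R - r)) \<le> C"
    using achievableD[OF R]
  proof eventually_elim
    case (elim n)
    define K where "K = nat \<lfloor>real n * \<Gamma> / 2\<rfloor>"
    from elim obtain g where
      "2 powr (real n * R) / 2 \<le> real (card {xs. length xs = n \<and> feasible g 2 K xs})"
      unfolding K_def by blast
    also have "\<dots> \<le> v 2 * \<rho> ^ n / \<mu> ^ Suc K"
      using mu \<open>0 < \<rho>\<close> v idle charged by (intro card_feasible_le) simp_all
    also have "\<dots> = v 2 / \<mu> * (\<rho> ^ n * \<mu> powr - real K)"
      using mu by (simp add: powr_minus powr_realpow field_simps)
    \<comment> \<open>As \<open>\<mu> \<le> 1\<close>, the bound increases with the number of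
      recharges.\<close>
    also have "\<dots> \<le> v 2 / \<mu> * (\<rho> ^ n * \<mu> powr - (real n * \<Gamma> / 2))"
    proof -
      have "real K \<le> real n * \<Gamma> / 2"
        unfolding K_def using \<open>0 \<le> \<Gamma>\<close> by (intro of_nat_floor) simp
      then have "\<mu> powr - real K \<le> \<mu> powr - (real n * \<Gamma> / 2)"
        using mu by (intro powr_mono') auto
      then show ?thesis
        using mu \<open>0 < v 2\<close> \<open>0 < \<rho>\<close> by (intro mult_left_mono) auto
    qed
    also have "\<rho> ^ n * \<mu> powr - (real n * \<Gamma> / 2) = 2 powr (real n * r)"
    proof -
      have "\<rho> ^ n = 2 powr (real n * log 2 \<rho>)"
        using \<open>0 < \<rho>\<close> by (simp add: powr_realpow [symmetric]) (simp add: powr_def log_def)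
      moreover have "\<mu> powr x = 2 powr (x * log 2 \<mu>)" for x
        using mu by (simp add: powr_def log_def)
      ultimately show ?thesis
        by (simp only: powr_add [symmetric]) (simp add: r_def algebra_simps)
    qed
    finally have "2 powr (real n * R) \<le> C * 2 powr (real n * r)"
      by (simp add: C_def field_simps)
    moreover have "2 powr (real n * R) = 2 powr (real n * (R - r)) * 2 powr (real n * r)"
      unfolding powr_add [symmetric] by (simp add: algebra_simps)
    ultimately show ?case by simp
  qed
  moreover have "\<forall>\<^sub>F n in sequentially. C < 2 powr (real n * (R - r))"
  proof -
    define d where "d = R - r"
    have "0 < d" using \<open>0 < R - r\<close> by (simp add: d_def)
    then have "filterlim (\<lambda>n. 2 powr (real n * d)) at_top sequentially"
      by real_asymp
    then show ?thesis unfolding d_def by (simp add: filterlim_at_top_dense)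
  qed
  ultimately have "\<forall>\<^sub>F n::nat in sequentially. False"
    by eventually_elim simp
  then show False by simp
qed

text \<open>The potential \<open>v\<close> belongs to the policy that recharges whenever the battery is not full.\<close>

lemma achievable_le_charge_nonfull:
  assumes "achievable noiseless_ternary \<Gamma> R" "0 \<le> \<Gamma>" and mu: "1 / 2 \<le> \<mu>" "\<mu> \<le> 1"
  shows "R \<le> log 2 (1 + 2 * \<mu>) - \<Gamma> / 2 * log 2 \<mu>"
proof -
  define v :: "nat \<Rightarrow> real" where "v b = (if b = 2 then 1 else \<mu>)" for b
  have sums: "sum v {..0} = \<mu>" "sum v {..1} = 2 * \<mu>" "sum v {..2} = 1 + 2 * \<mu>"
    by (simp_all add: v_def numeral_2_eq_2)
  have v: "v 0 = \<mu>" "v 1 = \<mu>" "v 2 = 1" by (simp_all add: v_def)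
  have "\<mu> \<le> v b" "sum v {..b} \<le> (1 + 2 * \<mu>) * v b" "\<mu> * sum v {..2} \<le> (1 + 2 * \<mu>) * v b"
    if "b \<le> 2" for b
  proof -
    \<comment> \<open>The first inequality, \<open>idle\<close> at level 1, is where
      \<open>1 / 2 \<le> \<mu>\<close> enters. On the decisions of the policy itself, equality
      holds.\<close>
    have le: "2 * \<mu> \<le> (1 + 2 * \<mu>) * \<mu>" "\<mu> * (1 + 2 * \<mu>) \<le> 1 + 2 * \<mu>" "\<mu> \<le> (1 + 2 * \<mu>) * \<mu>"
      using mu mult_right_mono[of 2 "1 + 2 * \<mu>" \<mu>] mult_right_mono[of \<mu> 1 "1 + 2 * \<mu>"]
        mult_right_mono[of 1 "1 + 2 * \<mu>" \<mu>] by simp_all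
    from that consider "b = 0" | "b = 1" | "b = 2" by linarith
    then have "\<mu> \<le> v b \<and> sum v {..b} \<le> (1 + 2 * \<mu>) * v b \<and> \<mu> * sum v {..2} \<le> (1 + 2 * \<mu>) * v b"
    proof cases
      case 1
      show ?thesis unfolding 1 sums v using le mu \<open>\<mu> \<le> 1\<close> by (simp add: mult.commute)
    next
      case 2
      show ?thesis unfolding 2 sums v using le mu \<open>\<mu> \<le> 1\<close> by (simp add: mult.commute)
    next
      case 3
      show ?thesis unfolding 3 sums v using le mu \<open>\<mu> \<le> 1\<close> by (simp add: mult.commute)
    qed
    then show "\<mu> \<le> v b" "sum v {..b} \<le> (1 + 2 * \<mu>) * v b"
      "\<mu> * sum v {..2} \<le> (1 + 2 * \<mu>) * v b" by blast+
  qed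
  then show ?thesis
    using mu by (intro achievable_le[OF assms(1,2), where v = v]) simp_all
qed

text \<open>The potential \<open>v\<close> belongs to the policy that recharges only the empty battery.\<close>

lemma achievable_le_charge_empty:
  assumes "achievable noiseless_ternary \<Gamma> R" "0 \<le> \<Gamma>" and rho: "1 < \<rho>" "\<rho> \<le> 2"
  shows "R \<le> log 2 \<rho> - \<Gamma> / 2 * log 2 ((\<rho> - 1)\<^sup>2 / \<rho>)"
proof -
  \<comment> \<open>\<open>(\<rho> - 1)\<^sup>2 = \<mu> * \<rho>\<close> is the characteristic
    equation of this policy; using \<open>\<rho>\<close> as the parameter avoids solving it.\<close>
  define s \<mu> where "s = \<rho> - 1" and "\<mu> = s\<^sup>2 / \<rho>"
  have s: "0 < s" "s \<le> 1" "\<rho> = 1 + s" using rho by (auto simp: s_def)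
  have ss: "s * s \<le> s" using s by (simp add: mult_left_le)
  have "s * s \<le> \<rho>" using s ss by linarith
  then have "\<mu> \<le> 1" using rho by (simp add: \<mu>_def power2_eq_square)
  have mu: "0 < \<mu>" "\<mu> \<le> s / \<rho>" "\<rho> * \<mu> = s\<^sup>2"
    unfolding \<mu>_def using s ss
    by (simp_all add: divide_right_mono power2_eq_square divide_le_eq_1_pos)
  define v :: "nat \<Rightarrow> real" where
    "v b = (if b = 0 then \<mu> else if b = 1 then s / \<rho> else 1)" for b
  have v: "v 0 = \<mu>" "v 1 = s / \<rho>" "v 2 = 1" by (simp_all add: v_def)
  have "\<mu> + s / \<rho> = s * (1 + s) / \<rho>"
    by (simp add: \<mu>_def power2_eq_square add_divide_distrib algebra_simps)
  then have mu_s: "\<mu> + s / \<rho> = s" using s by simp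
  have "sum v {..0} = \<mu>" "sum v {..1} = \<mu> + s / \<rho>" "sum v {..2} = 1 + (\<mu> + s / \<rho>)"
    by (simp_all add: v_def numeral_2_eq_2)
  then have sums: "sum v {..0} = \<mu>" "sum v {..1} = s" "sum v {..2} = \<rho>"
    unfolding mu_s using s by simp_all
  have "\<mu> \<le> v b" "sum v {..b} \<le> \<rho> * v b" "\<mu> * sum v {..2} \<le> \<rho> * v b"
    if "b \<le> 2" for b
  proof -
    \<comment> \<open>The last inequality, \<open>charged\<close> at level 1, amounts to
      \<open>s * s \<le> s\<close>, that is \<open>\<rho> \<le> 2\<close>.\<close>
    have le: "\<mu> \<le> \<rho> * \<mu>" "s = \<rho> * (s / \<rho>)" "\<mu> * \<rho> \<le> \<rho>" "\<mu> * \<rho> \<le> \<rho> * (s / \<rho>)"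
      using mu \<open>\<mu> \<le> 1\<close> rho s ss mult_right_mono[of 1 \<rho> \<mu>] mult_right_mono[of \<mu> 1 \<rho>]
      by (simp_all add: mult.commute[of \<mu>] power2_eq_square)
    from that consider "b = 0" | "b = 1" | "b = 2" by linarith
    then have "\<mu> \<le> v b \<and> sum v {..b} \<le> \<rho> * v b \<and> \<mu> * sum v {..2} \<le> \<rho> * v b"
    proof cases
      case 1
      show ?thesis unfolding 1 sums v using le(1) by (simp add: mult.commute)
    next
      case 2
      show ?thesis unfolding 2 sums v using le mu \<open>\<mu> \<le> 1\<close> by (simp add: mult.commute)
    next
      case 3
      show ?thesis unfolding 3 sums v using le(3) \<open>\<mu> \<le> 1\<close> by (simp add: mult.commute)
    qed
    then show "\<mu> \<le> v b" "sum v {..b} \<le> \<rho> * v b" "\<mu> * sum v {..2} \<le> \<rho> * v b" by blast+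
  qed
  then show ?thesis
    unfolding s_def[symmetric] \<mu>_def[symmetric] using mu \<open>\<mu> \<le> 1\<close> s
    by (intro achievable_le[OF assms(1,2), where v = v]) simp_all
qed

section \<open>Lower bounds by time sharing\<close>

lemma tendsto_nat_floor:
  assumes "0 \<le> c"
  shows "(\<lambda>n. real (nat \<lfloor>c * real n\<rfloor>) / real n) \<longlonglongrightarrow> c"
    and "(\<lambda>n. real (nat \<lfloor>c * real (n - 1)\<rfloor>) / real n) \<longlonglongrightarrow> c"
proof -
  have lower: "c * real m - 1 \<le> real (nat \<lfloor>c * real m\<rfloor>)"
    and upper: "real (nat \<lfloor>c * real m\<rfloor>) \<le> c * real m" for m
  proof -
    have "0 \<le> c * real m" using assms by simp
    then have "real (nat \<lfloor>c * real m\<rfloor>) = of_int \<lfloor>c * real m\<rfloor>" by simp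
    then show "c * real m - 1 \<le> real (nat \<lfloor>c * real m\<rfloor>)" "real (nat \<lfloor>c * real m\<rfloor>) \<le> c * real m"
      by linarith+
  qed
  show "(\<lambda>n. real (nat \<lfloor>c * real n\<rfloor>) / real n) \<longlonglongrightarrow> c"
  proof (rule tendsto_sandwich)
    show "(\<lambda>n. (c * real n - 1) / real n) \<longlonglongrightarrow> c" "(\<lambda>n. (c * real n) / real n) \<longlonglongrightarrow> c"
      by real_asymp+
  qed (intro always_eventually allI divide_right_mono lower upper; simp)+
  show "(\<lambda>n. real (nat \<lfloor>c * real (n - 1)\<rfloor>) / real n) \<longlonglongrightarrow> c"
  proof (rule tendsto_sandwich)
    show "(\<lambda>n. (c * real (n - 1) - 1) / real n) \<longlonglongrightarrow> c" "(\<lambda>n. (c * real (n - 1)) / real n) \<longlonglongrightarrow> c"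
      by real_asymp+
  qed (intro always_eventually allI divide_right_mono lower upper; simp)+
qed

lemma eventually_le_of_ratio:
  fixes A B :: "nat \<Rightarrow> nat"
  assumes "(\<lambda>n. real (A n) / real n) \<longlonglongrightarrow> a" "(\<lambda>n. real (B n) / real n) \<longlonglongrightarrow> b" "a < b"
  shows "\<forall>\<^sub>F n in sequentially. A n \<le> B n"
proof -
  obtain c where "a < c" "c < b" using dense[OF \<open>a < b\<close>] by blast
  then have "\<forall>\<^sub>F n in sequentially. real (A n) / real n < c" "\<forall>\<^sub>F n in sequentially. c < real (B n) / real n"
    using assms by (auto intro: order_tendstoD)
  then show ?thesis using eventually_gt_at_top[of 0]
  proof eventually_elim
    case (elim n)
    then have "real (A n) / real n < real (B n) / real n" by linarith
    then show ?case using elim by (simp add: divide_less_cancel)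
  qed
qed

text \<open>During a fraction \<open>\<theta>\<close> of the time every nonzero input is followed by a recharge, during the
  rest only the empty battery is recharged; \<open>\<kappa>\<close> and \<open>\<l>\<close> count the recharges of the two phases per
  unit of the total time.\<close>

lemma achievable_time_sharing:
  assumes \<theta>: "0 \<le> \<theta>" "\<theta> \<le> 1" and \<kappa>: "0 \<le> \<kappa>" "\<kappa> < \<theta> \<or> \<kappa> = 0"
    and \<l>: "0 \<le> \<l>" "\<l> < 1 - \<theta> \<or> \<l> = 0" and cost: "2 * (\<kappa> + \<l>) \<le> \<Gamma>" and "0 \<le> R"
    and R: "R < \<kappa> + binomial_exponent \<theta> \<kappa> + binomial_exponent (1 - \<theta> + \<l>) (2 * \<l>)"
  shows "achievable noiseless_ternary \<Gamma> R"
proof (rule achievableI)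
  show "0 \<le> R" "0 \<le> \<Gamma>" using assms by auto
  \<comment> \<open>\<open>n - 1\<close> keeps the second phase nonempty even for
    \<open>\<theta> = 1\<close>.\<close>
  define A where "A n = nat \<lfloor>\<theta> * real (n - 1)\<rfloor>" for n
  define K where "K n = nat \<lfloor>\<kappa> * real n\<rfloor>" for n
  define L where "L n = nat \<lfloor>\<l> * real n\<rfloor>" for n
  \<comment> \<open>The slack is shared by three estimates: the factor \<open>2 ^ K n\<close> and
    the two binomial coefficients.\<close>
  define \<epsilon> where "\<epsilon> = (\<kappa> + binomial_exponent \<theta> \<kappa> + binomial_exponent (1 - \<theta> + \<l>) (2 * \<l>) - R) / 3"
  have "0 < \<epsilon>" using R by (simp add: \<epsilon>_def)
  have A_less: "A n < n" if "0 < n" for n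
  proof -
    have "\<theta> * real (n - 1) \<le> real (n - 1)" using \<theta> by (simp add: mult_left_le_one_le)
    then have "A n \<le> n - 1" unfolding A_def by (metis floor_mono floor_of_nat nat_int nat_mono)
    then show ?thesis using that by simp
  qed
  have limA: "(\<lambda>n. real (A n) / real n) \<longlonglongrightarrow> \<theta>" and limK: "(\<lambda>n. real (K n) / real n) \<longlonglongrightarrow> \<kappa>"
    and limL: "(\<lambda>n. real (L n) / real n) \<longlonglongrightarrow> \<l>"
    unfolding A_def K_def L_def by (intro tendsto_nat_floor \<theta> \<kappa> \<l>)+
  have lim2L: "(\<lambda>n. real (2 * L n) / real n) \<longlonglongrightarrow> 2 * \<l>"
    using tendsto_mult[OF tendsto_const[of 2] limL] by simp
  have limB: "(\<lambda>n. real (n - A n + L n) / real n) \<longlonglongrightarrow> 1 - \<theta> + \<l>"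
  proof (rule Lim_transform_eventually)
    show "(\<lambda>n. 1 - real (A n) / real n + real (L n) / real n) \<longlonglongrightarrow> 1 - \<theta> + \<l>"
      by (intro tendsto_intros limA limL)
    show "\<forall>\<^sub>F n in sequentially. 1 - real (A n) / real n + real (L n) / real n = real (n - A n + L n) / real n"
      using eventually_gt_at_top[of 0]
    proof eventually_elim
      case (elim n)
      then show ?case using A_less[of n] by (simp add: field_simps of_nat_diff)
    qed
  qed
  \<comment> \<open>For \<open>\<kappa> = 0\<close> this is trivial, which admits
    \<open>\<theta> = 0\<close>; otherwise the limits are strictly ordered.\<close>
  have "\<forall>\<^sub>F n in sequentially. K n \<le> A n"
    using \<kappa>(2) eventually_le_of_ratio[OF limK limA] by (auto simp: K_def)
  from eventually_binomial_ge[OF limA limK this, of "binomial_exponent \<theta> \<kappa> - \<epsilon>"] \<open>0 < \<epsilon>\<close>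
  have ev1: "\<forall>\<^sub>F n in sequentially. real n * (binomial_exponent \<theta> \<kappa> - \<epsilon>) \<le> log 2 (real (A n choose K n))"
    by simp
  have "\<forall>\<^sub>F n in sequentially. 2 * L n \<le> n - A n + L n"
    using \<l>(2) eventually_le_of_ratio[OF lim2L limB] by (auto simp: L_def)
  from eventually_binomial_ge[OF limB lim2L this, of "binomial_exponent (1 - \<theta> + \<l>) (2 * \<l>) - \<epsilon>"] \<open>0 < \<epsilon>\<close>
  have ev2: "\<forall>\<^sub>F n in sequentially. real n * (binomial_exponent (1 - \<theta> + \<l>) (2 * \<l>) - \<epsilon>)
      \<le> log 2 (real (n - A n + L n choose (2 * L n)))"
    by simp
  have "\<forall>\<^sub>F n in sequentially. \<kappa> - \<epsilon> < real (K n) / real n"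
    using limK \<open>0 < \<epsilon>\<close> by (intro order_tendstoD) auto
  then show "\<forall>\<^sub>F n in sequentially. \<exists>k N. codewords 2 n k N \<and>
      2 * real k \<le> real n * \<Gamma> \<and> 2 powr (real n * R) \<le> real N"
    using ev1 ev2 \<open>\<forall>\<^sub>F n in sequentially. K n \<le> A n\<close> \<open>\<forall>\<^sub>F n in sequentially. 2 * L n \<le> n - A n + L n\<close>
      eventually_gt_at_top[of 0]
  proof eventually_elim
    case (elim n)
    let ?C = "A n choose K n" and ?D = "n - A n + L n choose (2 * L n)"
    have "codewords 2 (A n + (n - A n)) (K n + L n) (2 ^ K n * ?C * ?D)"
      using codewords_charge_empty[of "n - A n" "L n"] A_less[OF elim(6)]
      by (intro codewords_charge_nonfull) simp_all
    then have cw: "codewords 2 n (K n + L n) (2 ^ K n * ?C * ?D)"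
      using A_less[OF elim(6)] by simp
    have "real (K n) \<le> \<kappa> * real n" "real (L n) \<le> \<l> * real n"
      using \<kappa> \<l> by (simp_all add: K_def L_def)
    then have "2 * real (K n + L n) \<le> real n * (2 * (\<kappa> + \<l>))"
      by (simp add: algebra_simps)
    also have "\<dots> \<le> real n * \<Gamma>" using cost by (intro mult_left_mono) auto
    finally have cost': "2 * real (K n + L n) \<le> real n * \<Gamma>" .
    have pos: "0 < real ?C" "0 < real ?D" using elim by auto
    have "real n * (\<kappa> - \<epsilon>) \<le> real (K n)"
      using elim(1,6) by (simp add: field_simps)
    moreover have "real n * R = real n * (\<kappa> - \<epsilon>) + real n * (binomial_exponent \<theta> \<kappa> - \<epsilon>)
        + real n * (binomial_exponent (1 - \<theta> + \<l>) (2 * \<l>) - \<epsilon>)"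
      unfolding \<epsilon>_def by (simp add: field_simps)
    ultimately have "real n * R \<le> real (K n) + log 2 (real ?C) + log 2 (real ?D)"
      using elim(2,3) by linarith
    then have "2 powr (real n * R) \<le> 2 powr (real (K n) + log 2 (real ?C) + log 2 (real ?D))"
      by simp
    also have "\<dots> = real (2 ^ K n * ?C * ?D)"
      using pos by (simp add: powr_add powr_realpow)
    finally show ?case using cw cost' by blast
  qed
qed

section \<open>Evaluation of the capacity\<close>

lemma achievable_0: "0 \<le> \<Gamma> \<Longrightarrow> achievable noiseless_ternary \<Gamma> 0"
  using codewords_charge_empty[of _ 0]
  by (intro achievableI always_eventually allI exI[of _ 0] exI[of _ 1]) auto

text \<open>Rates strictly below \<open>C\<close> suffice by density; rate 0 handles negative
  approximants and thus the case \<open>C = 0\<close>.\<close>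

lemma capacity_eqI:
  assumes "0 \<le> \<Gamma>" and le: "\<And>R. achievable noiseless_ternary \<Gamma> R \<Longrightarrow> R \<le> C"
    and ge: "\<And>R. 0 \<le> R \<Longrightarrow> R < C \<Longrightarrow> achievable noiseless_ternary \<Gamma> R"
  shows "capacity_adjacent noiseless_ternary \<Gamma> = ereal C"
  unfolding capacity_adjacent_def
proof (rule antisym)
  show "(SUP R\<in>{R. achievable noiseless_ternary \<Gamma> R}. ereal R) \<le> ereal C"
    using le by (intro SUP_least) simp
  have zero: "achievable noiseless_ternary \<Gamma> 0" using assms(1) by (rule achievable_0)
  show "ereal C \<le> (SUP R\<in>{R. achievable noiseless_ternary \<Gamma> R}. ereal R)"
  proof (rule dense_le)
    fix y assume y: "y < ereal C"
    show "y \<le> (SUP R\<in>{R. achievable noiseless_ternary \<Gamma> R}. ereal R)"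
    proof (cases "0 \<le> y")
      case True
      then obtain R where "y = ereal R" "0 \<le> R" "R < C" using y by (cases y) auto
      then show ?thesis using ge by (intro SUP_upper2[of R]) auto
    next
      case False
      then have "y \<le> ereal 0" by (simp add: zero_ereal_def[symmetric])
      then show ?thesis using zero by (intro SUP_upper2[of 0]) auto
    qed
  qed
qed

lemma binomial_exponent_0 [simp]: "binomial_exponent a 0 = 0"
  by (simp add: binomial_exponent_def)

lemma binomial_exponent_half: "0 \<le> a \<Longrightarrow> binomial_exponent a (a / 2) = a"
  by (cases "a = 0") (simp_all add: binomial_exponent_def xlogx_def log_divide field_simps)

lemma binomial_exponent_1: "binomial_exponent 1 p = binary_entropy p"
  by (simp add: binomial_exponent_def binary_entropy_def xlogx_def)

text \<open>The unconstrained maximum: inputs that are nonzero two thirds of the time, each followed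
  by a recharge, reach rate \<open>log 2 3\<close>.\<close>

lemma binary_entropy_two_thirds: "2 / 3 + binary_entropy (2 / 3) = log 2 3"
proof -
  have "log 2 (2 / 3) = log 2 2 - log 2 (3::real)" "log 2 (1 / 3) = log 2 1 - log 2 (3::real)"
    by (rule log_divide_pos; simp)+
  moreover have "log 2 2 = (1::real)" "log 2 1 = (0::real)" "1 - 2 / 3 = (1 / 3 :: real)"
    by simp_all
  moreover have "2 / 3 + (- (2 / 3) * (1 - x) - 1 / 3 * (0 - x)) = x" for x :: real
    by (simp add: field_simps)
  ultimately show ?thesis
    unfolding binary_entropy_def by (simp only:)
qed
theorem proposition3:
  fixes \<Gamma> :: real
  assumes "0 \<le> \<Gamma>"
  shows "capacity_adjacent noiseless_ternary \<Gamma> = ereal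
    (if \<Gamma> = 0 then 0
     else if \<Gamma> < 2/3 then
       (1 + \<Gamma>/2) * log 2 ((2 + \<Gamma>) / (2 * \<Gamma>)) - (1 - \<Gamma>/2) * log 2 ((2 - \<Gamma>) / (2 * \<Gamma>))
     else if \<Gamma> < 1 then 1/2 * \<Gamma> + 1
     else if \<Gamma> < 4/3 then \<Gamma>/2 + binary_entropy (\<Gamma>/2)
     else log 2 3)"
proof -
  consider "\<Gamma> = 0" | "0 < \<Gamma>" "\<Gamma> < 2/3" | "2/3 \<le> \<Gamma>" "\<Gamma> < 1" | "1 \<le> \<Gamma>" "\<Gamma> < 4/3" | "4/3 \<le> \<Gamma>"
    using assms by linarith
  then show ?thesis
  proof cases
    case 1
    have "capacity_adjacent noiseless_ternary \<Gamma> = ereal 0"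
    proof (rule capacity_eqI[OF assms])
      fix R assume R: "achievable noiseless_ternary \<Gamma> R"
      \<comment> \<open>The recharge term vanishes at \<open>\<Gamma> = 0\<close>, and
        \<open>\<rho>\<close> may approach the excluded value 1.\<close>
      have "((\<lambda>\<rho>. log 2 \<rho>) \<longlongrightarrow> 0) (at_right (1::real))" by real_asymp
      moreover have "\<forall>\<^sub>F \<rho> in at_right (1::real). R \<le> log 2 \<rho>"
        using achievable_le_charge_empty[OF R assms] 1
        by (intro eventually_at_rightI[of 1 2]) auto
      ultimately show "R \<le> 0" by (rule tendsto_lowerbound) simp
    qed auto
    then show ?thesis using 1 by simp
  next
    case 2
    let ?C = "(1 + \<Gamma>/2) * log 2 ((2 + \<Gamma>) / (2 * \<Gamma>)) - (1 - \<Gamma>/2) * log 2 ((2 - \<Gamma>) / (2 * \<Gamma>))"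
    have "capacity_adjacent noiseless_ternary \<Gamma> = ereal ?C"
    proof (rule capacity_eqI[OF assms])
      fix R assume R: "achievable noiseless_ternary \<Gamma> R"
      \<comment> \<open>The minimiser of the upper bound over \<open>\<rho>\<close>; it satisfies
        \<open>\<rho> \<le> 2\<close> because \<open>\<Gamma> \<le> 2 / 3\<close>.\<close>
      define \<rho> where "\<rho> = (2 + \<Gamma>) / (2 - \<Gamma>)"
      have rho: "1 < \<rho>" "\<rho> \<le> 2" "\<rho> - 1 = 2 * \<Gamma> / (2 - \<Gamma>)"
        using 2 by (simp_all add: \<rho>_def field_simps)
      have "R \<le> log 2 \<rho> - \<Gamma> / 2 * log 2 ((\<rho> - 1)\<^sup>2 / \<rho>)"
        using R assms rho(1,2) by (rule achievable_le_charge_empty)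
      also have "\<dots> = (1 + \<Gamma> / 2) * log 2 \<rho> - \<Gamma> * log 2 (\<rho> - 1)"
        using rho(1) by (simp add: log_divide log_nat_power algebra_simps)
      also have "\<dots> = ?C"
        unfolding rho(3) unfolding \<rho>_def using 2
        by (simp add: log_divide_pos log_mult_pos) (simp add: algebra_simps)
      finally show "R \<le> ?C" .
    next
      fix R assume R: "0 \<le> R" "R < ?C"
      have "?C = binomial_exponent (1 + \<Gamma> / 2) \<Gamma>"
      proof -
        have "(2 + \<Gamma>) / (2 * \<Gamma>) = (1 + \<Gamma> / 2) / \<Gamma>" "(2 - \<Gamma>) / (2 * \<Gamma>) = (1 - \<Gamma> / 2) / \<Gamma>"
          using 2 by (simp_all add: field_simps)
        then show ?thesis
          using 2 by (simp add: binomial_exponent_def xlogx_def log_divide_pos algebra_simps)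
      qed
      then show "achievable noiseless_ternary \<Gamma> R"
        using R 2 by (intro achievable_time_sharing[of 0 0 "\<Gamma> / 2"]) auto
    qed
    then show ?thesis using 2 by simp
  next
    case 3
    have "capacity_adjacent noiseless_ternary \<Gamma> = ereal (1/2 * \<Gamma> + 1)"
    proof (rule capacity_eqI[OF assms])
      fix R assume "achievable noiseless_ternary \<Gamma> R"
      from achievable_le_charge_nonfull[OF this assms, of "1 / 2"]
      show "R \<le> 1/2 * \<Gamma> + 1" by (simp add: log_divide)
    next
      fix R assume R: "0 \<le> R" "R < 1/2 * \<Gamma> + 1"
      \<comment> \<open>Interpolates between the two policies at their endpoints
        \<open>\<Gamma> = 2 / 3\<close> and \<open>\<Gamma> = 1\<close>: a phase of length
        \<open>?\<theta>\<close> has recharges in half of its steps, the other, of length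
        \<open>3 * (1 - \<Gamma>)\<close>, in a third. The cost is exactly
        \<open>\<Gamma>\<close>.\<close>
      let ?\<theta> = "3 * \<Gamma> - 2"
      show "achievable noiseless_ternary \<Gamma> R"
      proof (rule achievable_time_sharing[of ?\<theta> "?\<theta> / 2" "1 - \<Gamma>"])
        have "binomial_exponent (1 - ?\<theta> + (1 - \<Gamma>)) (2 * (1 - \<Gamma>)) = 4 * (1 - \<Gamma>)"
        proof -
          have e: "1 - ?\<theta> + (1 - \<Gamma>) = 4 * (1 - \<Gamma>)" "2 * (1 - \<Gamma>) = 4 * (1 - \<Gamma>) / 2"
            by simp_all
          show ?thesis
            unfolding e(1) unfolding e(2) by (rule binomial_exponent_half) (use 3 in simp)
        qed
        then show "R < ?\<theta> / 2 + binomial_exponent ?\<theta> (?\<theta> / 2)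
            + binomial_exponent (1 - ?\<theta> + (1 - \<Gamma>)) (2 * (1 - \<Gamma>))"
          using R 3 binomial_exponent_half[of ?\<theta>] by (simp add: diff_divide_distrib)
        show "2 * (?\<theta> / 2 + (1 - \<Gamma>)) \<le> \<Gamma>" by (simp add: field_simps)
      qed (use R 3 in auto)
    qed
    then show ?thesis using 3 by simp
  next
    case 4
    let ?C = "\<Gamma>/2 + binary_entropy (\<Gamma>/2)"
    have "capacity_adjacent noiseless_ternary \<Gamma> = ereal ?C"
    proof (rule capacity_eqI[OF assms])
      fix R assume R: "achievable noiseless_ternary \<Gamma> R"
      \<comment> \<open>The minimiser of the upper bound over \<open>\<mu>\<close>; it lies between
        \<open>1 / 2\<close> and 1 for \<open>1 \<le> \<Gamma> \<le> 4 / 3\<close>.\<close>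
      define \<mu> where "\<mu> = \<Gamma> / (2 * (2 - \<Gamma>))"
      have mu: "1 / 2 \<le> \<mu>" "\<mu> \<le> 1" "1 + 2 * \<mu> = 1 / (1 - \<Gamma> / 2)" "\<mu> = (\<Gamma> / 2) / (2 * (1 - \<Gamma> / 2))"
        using 4 by (simp_all add: \<mu>_def field_simps)
      have "R \<le> log 2 (1 + 2 * \<mu>) - \<Gamma> / 2 * log 2 \<mu>"
        using R assms mu(1,2) by (rule achievable_le_charge_nonfull)
      also have "\<dots> = ?C"
      proof -
        define p where "p = \<Gamma> / 2"
        have "0 < p" "p < 1" using 4 by (auto simp: p_def)
        moreover from this have "log 2 (2 * (1 - p)) = 1 + log 2 (1 - p)"
          by (subst log_mult_pos) simp_all
        ultimately have "log 2 (1 / (1 - p)) - p * log 2 (p / (2 * (1 - p))) = p + binary_entropy p"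
          by (simp add: log_divide_pos binary_entropy_def del: right_diff_distrib_numeral)
            (simp add: algebra_simps)
        then show ?thesis unfolding mu(3) unfolding mu(4) p_def .
      qed
      finally show "R \<le> ?C" .
    next
      fix R assume "0 \<le> R" "R < ?C"
      then show "achievable noiseless_ternary \<Gamma> R"
        using 4 by (intro achievable_time_sharing[of 1 "\<Gamma> / 2" 0]) (auto simp: binomial_exponent_1)
    qed
    then show ?thesis using 4 by simp
  next
    case 5
    have "capacity_adjacent noiseless_ternary \<Gamma> = ereal (log 2 3)"
    proof (rule capacity_eqI[OF assms])
      fix R assume "achievable noiseless_ternary \<Gamma> R"
      \<comment> \<open>\<open>\<mu> = 1\<close> puts no price on recharges and leaves the trivial
        bound.\<close>
      from achievable_le_charge_nonfull[OF this assms, of 1]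
      show "R \<le> log 2 3" by simp
    next
      fix R assume "0 \<le> R" "R < log 2 3"
      then show "achievable noiseless_ternary \<Gamma> R"
        using 5 binary_entropy_two_thirds by (intro achievable_time_sharing[of 1 "2 / 3" 0]) (auto simp: binomial_exponent_1)
    qed
    then show ?thesis using 5 by simp
  qed
qed

end
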